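(* Let $G$ be a group with identity $e$, let $A$ be a non-empty subset of $G$, and let $\partial A=A^{-1}A\setminus\{e\}$. (i) A subset $B\subseteq G$ is a right $s$-factor of $G$ associated with $A$ if and only if $B$ is a maximal independent set in the Cayley graph $\operatorname{Cay}(G,\partial A)$. (ii) Moreover, if $G$ is finite, then $$|G:A|^+=\alpha\bigl(\operatorname{Cay}(G,\partial A)\bigr),\qquad |G:A|^-=i\bigl(\operatorname{Cay}(G,\partial A)\bigr).$$
   Context: For subsets $A,B$ of a group, $A^{-1}=\{a^{-1}\mid a\in A\}$ and $AB=\{ab\mid a\in A,\ b\in B\}$. A non-empty subset $B\subseteq G$ is called a right $s$-factor of $G$ associated with $A$ if every element $x\in AB$ can be written uniquely as $x=ab$ with $a\in A$, $b\in B$, and $B$ is maximal with respect to inclusion among subsets with this property. For $G$ finite, $|G:A|^+$ and $|G:A|^-$ denote the sizes of a largest and of a smallest right $s$-factor of $G$ associated with $A$, respectively. For a subset $S\subseteq G$ with $e\notin S$ and $S=S^{-1}$, the (left) Cayley graph $\operatorname{Cay}(G,S)$ is the simple graph with vertex set $G$ in which $u,v$ are adjacent if and only if $vu^{-1}\in S$. An independent set is a set of pairwise non-adjacent vertices; it is maximal if it is not properly contained in another independent set. For a finite graph $\Gamma$, $\alpha(\Gamma)$ is the size of a largest independent set and $i(\Gamma)$ is the size of a smallest maximal independent set. *)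

theory Defs
  imports "HOL-Algebra.Coset" "Graph_Theory.Pair_Digraph"
begin

section \<open>Right s-factors\<close>

definition direct_product_sets :: "('a, 'm) monoid_scheme \<Rightarrow> 'a set \<Rightarrow> 'a set \<Rightarrow> bool" where
  "direct_product_sets G A B \<longleftrightarrow>
     (\<forall>x \<in> A <#>\<^bsub>G\<^esub> B. \<exists>!p. p \<in> A \<times> B \<and> x = fst p \<otimes>\<^bsub>G\<^esub> snd p)"

definition right_s_factor :: "('a, 'm) monoid_scheme \<Rightarrow> 'a set \<Rightarrow> 'a set \<Rightarrow> bool" where
  "right_s_factor G A B \<longleftrightarrow>
     B \<subseteq> carrier G \<and> B \<noteq> {} \<and> direct_product_sets G A B \<and>
     (\<forall>C. C \<subseteq> carrier G \<and> direct_product_sets G A C \<and> B \<subseteq> C \<longrightarrow> C = B)"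

text \<open>The sizes $|G:A|^+$ and $|G:A|^-$; meaningful only when the carrier is finite.\<close>

definition upper_index :: "('a, 'm) monoid_scheme \<Rightarrow> 'a set \<Rightarrow> nat" where
  "upper_index G A = Max (card ` {B. right_s_factor G A B})"

definition lower_index :: "('a, 'm) monoid_scheme \<Rightarrow> 'a set \<Rightarrow> nat" where
  "lower_index G A = Min (card ` {B. right_s_factor G A B})"

section \<open>Independent sets\<close>

text \<open>
  An undirected graph is a symmetric digraph. The relation \<^const>\<open>pairwise\<close> only compares
  distinct vertices, in both orders.
\<close>

definition independent_set :: "('a, 'b) pre_digraph \<Rightarrow> 'a set \<Rightarrow> bool" where
  "independent_set \<Gamma> I \<longleftrightarrow> I \<subseteq> verts \<Gamma> \<and> pairwise (\<lambda>u v. \<not> u \<rightarrow>\<^bsub>\<Gamma>\<^esub> v) I"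

definition maximal_independent_set :: "('a, 'b) pre_digraph \<Rightarrow> 'a set \<Rightarrow> bool" where
  "maximal_independent_set \<Gamma> I \<longleftrightarrow>
     independent_set \<Gamma> I \<and> \<not> (\<exists>J. independent_set \<Gamma> J \<and> I \<subset> J)"

text \<open>The numbers $\alpha(\Gamma)$ and $i(\Gamma)$; meaningful only for finite graphs.\<close>

definition independence_number :: "('a, 'b) pre_digraph \<Rightarrow> nat" where
  "independence_number \<Gamma> = Max (card ` {I. independent_set \<Gamma> I})"

definition independent_domination_number :: "('a, 'b) pre_digraph \<Rightarrow> nat" where
  "independent_domination_number \<Gamma> = Min (card ` {I. maximal_independent_set \<Gamma> I})"

section \<open>Cayley graphs\<close>

definition cayley_graph :: "('a, 'm) monoid_scheme \<Rightarrow> 'a set \<Rightarrow> 'a pair_pre_digraph" where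
  "cayley_graph G S =
     \<lparr>pverts = carrier G,
      parcs = {(u, v). u \<in> carrier G \<and> v \<in> carrier G \<and> v \<otimes>\<^bsub>G\<^esub> inv\<^bsub>G\<^esub> u \<in> S}\<rparr>"

text \<open>The set $\partial A = A^{-1}A \setminus \{e\}$.\<close>

definition boundary_set :: "('a, 'm) monoid_scheme \<Rightarrow> 'a set \<Rightarrow> 'a set" where
  "boundary_set G A = ((set_inv\<^bsub>G\<^esub> A) <#>\<^bsub>G\<^esub> A) - {\<one>\<^bsub>G\<^esub>}"

lemma (in group) cayley_graph_simple:
  assumes "\<one> \<notin> S" and "S \<subseteq> carrier G" and "set_inv S = S"
  shows "pair_bidirected_digraph (cayley_graph G S)"
proof
  fix e assume "e \<in> parcs (cayley_graph G S)"
  then show "fst e \<in> pverts (cayley_graph G S)" "snd e \<in> pverts (cayley_graph G S)"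
    and "fst e \<noteq> snd e"
    using assms(1) by (auto simp: cayley_graph_def)
next
  have inv_S: "inv s \<in> S" if "s \<in> S" for s
    using that assms(3) by (auto simp: SET_INV_def)
  have "u \<otimes> inv v \<in> S"
    if "u \<in> carrier G" "v \<in> carrier G" "v \<otimes> inv u \<in> S" for u v
    using inv_S[OF that(3)] that(1,2) by (simp add: inv_mult_group)
  then show "symmetric (with_proj (cayley_graph G S))"
    by (auto simp: symmetric_def arcs_ends_conv cayley_graph_def intro!: symI)
qed

lemma (in group) boundary_set_connection_set:
  assumes "A \<subseteq> carrier G"
  shows "\<one> \<notin> boundary_set G A" and "boundary_set G A \<subseteq> carrier G"
    and "set_inv (boundary_set G A) = boundary_set G A"
proof -
  show "\<one> \<notin> boundary_set G A" by (simp add: boundary_set_def)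
  show sub: "boundary_set G A \<subseteq> carrier G"
    using assms by (auto simp: boundary_set_def set_mult_def SET_INV_def)
  have inv_mem: "inv x \<in> boundary_set G A" if x: "x \<in> boundary_set G A" for x
  proof -
    obtain a b where ab: "a \<in> A" "b \<in> A" "x = inv a \<otimes> b" "x \<noteq> \<one>"
      using x by (auto simp: boundary_set_def set_mult_def SET_INV_def)
    then have car: "a \<in> carrier G" "b \<in> carrier G" using assms by auto
    have "inv x = inv b \<otimes> a" using ab car by (simp add: inv_mult_group)
    moreover have "inv x \<noteq> \<one>" using ab car by (metis inv_closed inv_eq_1_iff m_closed)
    ultimately show ?thesis
      using ab by (auto simp: boundary_set_def set_mult_def SET_INV_def)
  qed
  show "set_inv (boundary_set G A) = boundary_set G A"
  proof
    show "set_inv (boundary_set G A) \<subseteq> boundary_set G A"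
      using inv_mem by (auto simp: SET_INV_def)
    show "boundary_set G A \<subseteq> set_inv (boundary_set G A)"
    proof
      fix x assume x: "x \<in> boundary_set G A"
      then have "x = inv (inv x)" using sub by auto
      then show "x \<in> set_inv (boundary_set G A)"
        using inv_mem[OF x] by (auto simp: SET_INV_def)
    qed
  qed
qed

end

theory Submission
  imports Defs
begin

text \<open>
  The equation \<open>a \<otimes> b = a' \<otimes> b'\<close> says that \<open>inv a' \<otimes> a = b' \<otimes> inv b\<close>, so a product
  \<open>A <#> B\<close> is direct exactly when no \<open>b' \<otimes> inv b\<close> with distinct \<open>b, b' \<in> B\<close> lies in
  \<open>\<partial>A\<close>. Hence directness is independence in the Cayley graph, and the two notions of
  maximality coincide.
\<close>

lemma independent_set_cayley_graph_iff:
  "independent_set (with_proj (cayley_graph G S)) B \<longleftrightarrow>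
     B \<subseteq> carrier G \<and> (\<forall>u\<in>B. \<forall>v\<in>B. u \<noteq> v \<longrightarrow> v \<otimes>\<^bsub>G\<^esub> inv\<^bsub>G\<^esub> u \<notin> S)"
  by (auto simp: independent_set_def pairwise_def cayley_graph_def arcs_ends_conv)

context group
begin

lemma boundary_set_eq:
  "boundary_set G A = {inv a \<otimes> a' |a a'. a \<in> A \<and> a' \<in> A} - {\<one>}"
  by (auto simp: boundary_set_def set_mult_def SET_INV_def)

text \<open>Multiplying by \<open>inv a'\<close> on the left and \<open>inv b\<close> on the right
  separates the factors: one side has the shape of an element of \<open>boundary_set\<close>, the
  other that of the quotient tested for adjacency.\<close>

lemma mult_eq_mult_iff:
  assumes "a \<in> carrier G" "a' \<in> carrier G" "b \<in> carrier G" "b' \<in> carrier G"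
  shows "a \<otimes> b = a' \<otimes> b' \<longleftrightarrow> inv a' \<otimes> a = b' \<otimes> inv b"
proof -
  have "a \<otimes> b = a' \<otimes> b' \<longleftrightarrow> a = a' \<otimes> b' \<otimes> inv b"
    using assms by (auto simp: inv_solve_right)
  also have "\<dots> \<longleftrightarrow> inv a' \<otimes> a = b' \<otimes> inv b"
    using assms by (simp add: inv_solve_left' m_assoc)
  finally show ?thesis .
qed

text \<open>Every element of \<open>A <#> B\<close> has a factorisation by definition, so only
  injectivity of the product map on \<open>A \<times> B\<close> is at stake.\<close>

lemma direct_product_sets_iff:
  "direct_product_sets G A B \<longleftrightarrow>
     (\<forall>a\<in>A. \<forall>b\<in>B. \<forall>a'\<in>A. \<forall>b'\<in>B. a \<otimes> b = a' \<otimes> b' \<longrightarrow> a = a' \<and> b = b')"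
    (is "?L \<longleftrightarrow> ?R")
proof
  assume L: ?L
  show ?R
  proof (intro ballI impI)
    fix a b a' b'
    assume ab: "a \<in> A" "b \<in> B" "a' \<in> A" "b' \<in> B" and eq: "a \<otimes> b = a' \<otimes> b'"
    have "a \<otimes> b \<in> A <#> B" using ab by (auto simp: set_mult_def)
    then have "\<exists>!p. p \<in> A \<times> B \<and> a \<otimes> b = fst p \<otimes> snd p"
      using L by (simp add: direct_product_sets_def)
    moreover have "(a, b) \<in> A \<times> B \<and> a \<otimes> b = fst (a, b) \<otimes> snd (a, b)"
      "(a', b') \<in> A \<times> B \<and> a \<otimes> b = fst (a', b') \<otimes> snd (a', b')"
      using ab eq by auto
    ultimately have "(a, b) = (a', b')" by blast
    then show "a = a' \<and> b = b'" by simp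
  qed
next
  assume R: ?R
  show ?L
    unfolding direct_product_sets_def
  proof
    fix x assume "x \<in> A <#> B"
    then obtain a b where ab: "a \<in> A" "b \<in> B" "x = a \<otimes> b"
      by (auto simp: set_mult_def)
    show "\<exists>!p. p \<in> A \<times> B \<and> x = fst p \<otimes> snd p"
    proof (rule ex1I[of _ "(a, b)"])
      show "(a, b) \<in> A \<times> B \<and> x = fst (a, b) \<otimes> snd (a, b)" using ab by simp
      fix p assume "p \<in> A \<times> B \<and> x = fst p \<otimes> snd p"
      then show "p = (a, b)" using R ab by (cases p) auto
    qed
  qed
qed

lemma direct_product_sets_iff_independent_set:
  assumes "A \<subseteq> carrier G" "B \<subseteq> carrier G"
  shows "direct_product_sets G A B \<longleftrightarrow>
    independent_set (with_proj (cayley_graph G (boundary_set G A))) B"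
proof
  assume dir: "direct_product_sets G A B"
  have "v \<otimes> inv u \<notin> boundary_set G A" if uv: "u \<in> B" "v \<in> B" "u \<noteq> v" for u v
  proof
    assume "v \<otimes> inv u \<in> boundary_set G A"
    then obtain a a' where a: "a \<in> A" "a' \<in> A" "inv a' \<otimes> a = v \<otimes> inv u"
      by (auto simp: boundary_set_eq)
    have "a \<in> carrier G" "a' \<in> carrier G" "u \<in> carrier G" "v \<in> carrier G"
      using a(1,2) uv(1,2) assms by auto
    \<comment> \<open>An arc between \<open>u\<close> and \<open>v\<close> thus yields two
      factorisations of one element.\<close>
    from mult_eq_mult_iff[OF this] have "a \<otimes> u = a' \<otimes> v"
      using a(3) by (rule iffD2)
    then show False
      using dir a(1,2) uv unfolding direct_product_sets_iff by blast
  qed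
  then show "independent_set (with_proj (cayley_graph G (boundary_set G A))) B"
    using assms by (auto simp: independent_set_cayley_graph_iff)
next
  assume ind: "independent_set (with_proj (cayley_graph G (boundary_set G A))) B"
  show "direct_product_sets G A B"
    unfolding direct_product_sets_iff
  proof (intro ballI impI)
    fix a b a' b'
    assume ab: "a \<in> A" "b \<in> B" "a' \<in> A" "b' \<in> B" and eq: "a \<otimes> b = a' \<otimes> b'"
    have car: "a \<in> carrier G" "a' \<in> carrier G" "b \<in> carrier G" "b' \<in> carrier G"
      using ab assms by auto
    have q: "inv a' \<otimes> a = b' \<otimes> inv b"
      using mult_eq_mult_iff[OF car] eq by (rule iffD1)
    have "b = b'"
    proof (rule ccontr)
      assume ne: "b \<noteq> b'"
      \<comment> \<open>If the product were \<open>\<one>\<close>, \<open>inv_equality\<close> would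
        make \<open>b'\<close> the inverse of \<open>inv b\<close>, which is \<open>b\<close>. So
        removing \<open>\<one>\<close> from the connection set does not lose this quotient.\<close>
      then have "b' \<otimes> inv b \<noteq> \<one>"
        using car using inv_equality[of b' "inv b"] by auto
      then have "b' \<otimes> inv b \<in> boundary_set G A"
        using q[symmetric] ab(1,3) unfolding boundary_set_eq by blast
      then show False
        using ind ab ne by (auto simp: independent_set_cayley_graph_iff)
    qed
    \<comment> \<open>With equal second factors, right cancellation gives
      \<open>a = a'\<close>.\<close>
    then show "a = a' \<and> b = b'" using eq car by simp
  qed
qed

text \<open>Both notions ask for inclusion-maximal members of the same family of subsets of the
  carrier; only the condition \<open>B \<noteq> {}\<close> needs a separate argument.\<close>

lemma right_s_factor_iff_maximal_independent_set:
  assumes A: "A \<subseteq> carrier G"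
  shows "right_s_factor G A B \<longleftrightarrow>
    maximal_independent_set (with_proj (cayley_graph G (boundary_set G A))) B"
    (is "_ \<longleftrightarrow> maximal_independent_set ?\<Gamma> B")
proof -
  have ind: "independent_set ?\<Gamma> C \<longleftrightarrow> C \<subseteq> carrier G \<and> direct_product_sets G A C" for C
    using direct_product_sets_iff_independent_set[OF A]
    by (auto simp: independent_set_cayley_graph_iff)
  \<comment> \<open>A singleton is independent and properly contains \<open>{}\<close>, so
    \<open>{}\<close> is not maximal.\<close>
  have "independent_set ?\<Gamma> {\<one>}"
    by (auto simp: independent_set_cayley_graph_iff)
  then have "B \<noteq> {}" if "maximal_independent_set ?\<Gamma> B"
    using that by (auto simp: maximal_independent_set_def)
  then show ?thesis
    unfolding right_s_factor_def maximal_independent_set_def ind by blast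
qed

end

text \<open>An independent set of largest size cannot be enlarged, so the maximum over all
  independent sets is attained at a maximal one. This bridges to \<open>upper_index\<close>, which
  ranges over s-factors and hence over maximal sets only.\<close>

lemma independence_number_eq_Max_maximal:
  assumes fin: "finite (verts \<Gamma>)"
  shows "independence_number \<Gamma> = Max (card ` {I. maximal_independent_set \<Gamma> I})"
proof -
  let ?I = "{I. independent_set \<Gamma> I}"
  have "?I \<subseteq> Pow (verts \<Gamma>)" by (auto simp: independent_set_def)
  then have finI: "finite ?I" using fin by (meson finite_Pow_iff finite_subset)
  \<comment> \<open>The family is non-empty, so \<open>Max\<close> is attained.\<close>
  have "{} \<in> ?I" by (simp add: independent_set_def)
  then have "Max (card ` ?I) \<in> card ` ?I"
    using finI by (intro Max_in) auto
  then obtain J where J: "independent_set \<Gamma> J" "card J = Max (card ` ?I)" by auto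
  have le: "card K \<le> card J" if "independent_set \<Gamma> K" for K
    using that finI J(2) by simp
  have "maximal_independent_set \<Gamma> J"
    unfolding maximal_independent_set_def
  proof (intro conjI notI J(1))
    assume "\<exists>K. independent_set \<Gamma> K \<and> J \<subset> K"
    then obtain K where K: "independent_set \<Gamma> K" "J \<subset> K" by blast
    then have "finite K" using fin by (auto simp: independent_set_def intro: finite_subset)
    then have "card J < card K" using K(2) by (rule psubset_card_mono)
    then show False using le[OF K(1)] by simp
  qed
  moreover have sub: "{I. maximal_independent_set \<Gamma> I} \<subseteq> ?I"
    by (auto simp: maximal_independent_set_def)
  ultimately have "Max (card ` {I. maximal_independent_set \<Gamma> I}) = card J"
    using le finite_subset[OF sub finI] by (intro Max_eqI) auto
  then show ?thesis using J(2) by (simp add: independence_number_def)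
qed

theorem lemma2:
  fixes G :: "('a, 'm) monoid_scheme" and A :: "'a set"
  assumes "group G" and "A \<subseteq> carrier G" and "A \<noteq> {}"
  shows "(\<forall>B. B \<subseteq> carrier G \<longrightarrow>
            (right_s_factor G A B \<longleftrightarrow>
             maximal_independent_set (cayley_graph G (boundary_set G A)) B)) \<and>
         (finite (carrier G) \<longrightarrow>
            upper_index G A = independence_number (cayley_graph G (boundary_set G A)) \<and>
            lower_index G A = independent_domination_number (cayley_graph G (boundary_set G A)))"
proof -
  \<comment> \<open>This spells out the coercion \<open>with_proj\<close>, implicit in the
    statement.\<close>
  let ?\<Gamma> = "with_proj (cayley_graph G (boundary_set G A))"
  have iff: "right_s_factor G A B \<longleftrightarrow> maximal_independent_set ?\<Gamma> B" for B
    using group.right_s_factor_iff_maximal_independent_set[OF assms(1,2)] .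
  have "verts ?\<Gamma> = carrier G" by (simp add: cayley_graph_def)
  \<comment> \<open>By \<open>iff\<close> the families of sets agree, which settles
    \<open>lower_index\<close> by unfolding; \<open>upper_index\<close> also needs the lemma on
    \<open>Max\<close>.\<close>
  then show ?thesis
    using independence_number_eq_Max_maximal[of ?\<Gamma>]
    by (simp add: iff upper_index_def lower_index_def independent_domination_number_def)
qed

end
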